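(* Let $A,L\in\mathbb{R}^{N\times N}$, $b\in\mathbb{R}^N$, let $W_m\in\mathbb{R}^{N\times m}$, $W_{m+1}\in\mathbb{R}^{N\times(m+1)}$ and $\overline H_m\in\mathbb{R}^{(m+1)\times m}$ be the matrices produced by $m$ steps of the Arnoldi algorithm applied to $A$ and $b$, so that $AW_m=W_{m+1}\overline H_m$, and let $L_m:=W_m^TLW_m\in\mathbb{R}^{m\times m}$. Let $\overline H_mX^{(m)}=U^{(m)}S^{(m)}$ and $L_mX^{(m)}=V^{(m)}C^{(m)}$, with $S^{(m)}=\mathrm{diag}(s_1^{(m)},\dots,s_m^{(m)})$ and $C^{(m)}=\mathrm{diag}(c_1^{(m)},\dots,c_m^{(m)})$, be the generalized SVD of the matrix pair $(\overline H_m,L_m)$. Let $u_k^{(m)}$, $v_k^{(m)}$ and $x_k^{(m)}$ be the $k$-th columns of the matrices $U^{(m)}\in\mathbb{R}^{(m+1)\times m}$, $V^{(m)}\in\mathbb{R}^{m\times m}$ and $X^{(m)}\in\mathbb{R}^{m\times m}$ respectively. Then, defining $\overline u_k=W_{m+1}u_k^{(m)}$, $\overline v_k=W_mv_k^{(m)}$ and $\overline x_k=W_mx_k^{(m)}$, we have $$A\overline x_k-s_k^{(m)}\overline u_k=0,$$ $$W_m^T\left(L\overline x_k-c_k^{(m)}\overline v_k\right)=0.$$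
   Context: The Arnoldi algorithm applied to $A$ and $b$ builds (in exact arithmetic) an orthonormal basis $w_1,\dots,w_m$ of the Krylov subspace $\mathcal{K}_m(A,b)=\mathrm{span}\{b,Ab,\dots,A^{m-1}b\}$, starting from $w_1=b/\|b\|$. With $W_m=[w_1,\dots,w_m]$ it satisfies $AW_m=W_mH_m+h_{m+1,m}w_{m+1}e_m^T$, where $H_m=(h_{i,j})\in\mathbb{R}^{m\times m}$ is upper Hessenberg and $e_m=(0,\dots,0,1)^T\in\mathbb{R}^m$; equivalently $AW_m=W_{m+1}\overline H_m$, where $W_{m+1}=[w_1,\dots,w_{m+1}]$ has orthonormal columns and $\overline H_m=\begin{bmatrix}H_m\\ h_{m+1,m}e_m^T\end{bmatrix}\in\mathbb{R}^{(m+1)\times m}$. It is assumed that the process has not terminated before producing $w_{m+1}$ (i.e. $h_{j+1,j}\ne0$ for $1\le j\le m$). $L$ is the regularization matrix, made square ($N\times N$) by appending zero rows if necessary. In the generalized SVD of $(\overline H_m,L_m)$, $X^{(m)}$ is nonsingular, and $U^{(m)}$ and $V^{(m)}$ have orthonormal columns. *)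

theory Defs
  imports Complex_Main "Jordan_Normal_Form.Matrix"
begin

text \<open>Vectors, matrices and the sequences built from them are indexed from 0: the vector
  $w_{j+1}$ of the usual presentation is the list element number \<open>j\<close>, and $h_{i+1,j+1}$ is the
  matrix entry \<open>(i, j)\<close>.\<close>

definition vnorm :: "real vec \<Rightarrow> real" where
  "vnorm v = sqrt (v \<bullet> v)"

definition orthonormal_cols :: "real mat \<Rightarrow> bool" where
  "orthonormal_cols Q \<longleftrightarrow>
     (\<forall>i<dim_col Q. \<forall>j<dim_col Q. col Q i \<bullet> col Q j = (if i = j then 1 else 0))"

text \<open>Given the vectors $w_1,\dots,w_j$ computed so far, \<open>arnoldi_resid\<close> is the next direction before
  normalization: $b$ at the start, and $Aw_j - \sum_{i\le j} (w_i^T A w_j)\, w_i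
  = Aw_j - W_j W_j^T A w_j$ afterwards.\<close>

definition arnoldi_resid :: "real mat \<Rightarrow> real vec \<Rightarrow> real vec list \<Rightarrow> real vec" where
  "arnoldi_resid A b ws =
     (if ws = [] then b
      else let W = mat_of_cols (dim_vec b) ws; z = A *\<^sub>v last ws
           in z - W *\<^sub>v (W\<^sup>T *\<^sub>v z))"

text \<open>\<open>arnoldi_vecs A b m\<close> is the list $[w_1,\dots,w_m]$. A breakdown is not treated specially: since
  \<open>1 / 0 = 0\<close>, a zero residual yields a zero vector, and it shows up as a zero subdiagonal entry
  of \<open>arnoldi_H\<close> below.\<close>

fun arnoldi_vecs :: "real mat \<Rightarrow> real vec \<Rightarrow> nat \<Rightarrow> real vec list" where
  "arnoldi_vecs A b 0 = []"
| "arnoldi_vecs A b (Suc j) =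
     (let ws = arnoldi_vecs A b j; r = arnoldi_resid A b ws
      in ws @ [(1 / vnorm r) \<cdot>\<^sub>v r])"

definition arnoldi_W :: "real mat \<Rightarrow> real vec \<Rightarrow> nat \<Rightarrow> real mat" where
  "arnoldi_W A b m = mat_of_cols (dim_vec b) (arnoldi_vecs A b m)"

text \<open>The $(m+1)\times m$ upper Hessenberg matrix $\overline H_m$ of the coefficients computed by the
  algorithm: $h_{i,j} = w_i^T A w_j$ for $i \le j$, and $h_{j+1,j}$ is the norm by which the
  residual is divided to give $w_{j+1}$. The relation $A W_m = W_{m+1}\overline H_m$ is a
  consequence of these definitions, not part of them.\<close>

definition arnoldi_H :: "real mat \<Rightarrow> real vec \<Rightarrow> nat \<Rightarrow> real mat" where
  "arnoldi_H A b m = mat (Suc m) m (\<lambda>(i, j).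
     if i \<le> j then (arnoldi_vecs A b m ! i) \<bullet> (A *\<^sub>v (arnoldi_vecs A b m ! j))
     else if i = Suc j then vnorm (arnoldi_resid A b (arnoldi_vecs A b (Suc j)))
     else 0)"

text \<open>Generalized SVD \<open>H X = U S\<close>, \<open>K X = V C\<close> of a pair \<open>(H, K)\<close> with \<open>m\<close> columns each, where
  \<open>S = diag(s)\<close> and \<open>C = diag(c)\<close>. Only the first \<open>m\<close> values of \<open>s\<close> and \<open>c\<close> matter. No particular
  ordering, sign or scaling convention (such as $s_k^2 + c_k^2 = 1$) is imposed on \<open>s\<close> and \<open>c\<close>,
  so that every such convention is covered.\<close>

definition is_gsvd ::
  "real mat \<Rightarrow> real mat \<Rightarrow> real mat \<Rightarrow> real mat \<Rightarrow> real mat \<Rightarrow> (nat \<Rightarrow> real) \<Rightarrow> (nat \<Rightarrow> real) \<Rightarrow> bool"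
  where
  "is_gsvd H K U V X s c \<longleftrightarrow>
     (let m = dim_col H in
        dim_col K = m \<and>
        U \<in> carrier_mat (dim_row H) m \<and> orthonormal_cols U \<and>
        V \<in> carrier_mat (dim_row K) m \<and> orthonormal_cols V \<and>
        X \<in> carrier_mat m m \<and> invertible_mat X \<and>
        H * X = U * mat_diag m s \<and>
        K * X = V * mat_diag m c)"

end

theory Submission
  imports Defs
begin

text \<open>The Arnoldi residual is orthogonal to the vectors already computed, and rearranging its
  definition gives $AW_m = W_{m+1}\overline H_m$; without breakdown the normalized residuals are
  orthonormal, so $W_m^TW_m = I$. Multiplying the $k$-th column of $\overline H_mX = US$ by $W_{m+1}$
  gives the first equation; the $k$-th column of $L_mX = VC$ is the second, because
  $W_m^T\overline v_k = W_m^TW_mv_k = v_k$.\<close>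

text \<open>Indexes the basis vectors independently of the number of steps, so that the lists for
  different \<open>m\<close> are visibly prefixes of one sequence and the columns of
  \<open>arnoldi_W\<close> can be compared across \<open>m\<close>.\<close>

definition arnoldi_vec :: "real mat \<Rightarrow> real vec \<Rightarrow> nat \<Rightarrow> real vec" where
  "arnoldi_vec A b j =
     (let r = arnoldi_resid A b (arnoldi_vecs A b j) in (1 / vnorm r) \<cdot>\<^sub>v r)"

lemma arnoldi_vecs_eq_map: "arnoldi_vecs A b m = map (arnoldi_vec A b) [0..<m]"
  by (induction m) (auto simp: arnoldi_vec_def Let_def)

lemma length_arnoldi_vecs [simp]: "length (arnoldi_vecs A b m) = m"
  by (simp add: arnoldi_vecs_eq_map)

lemma nth_arnoldi_vecs [simp]: "j < m \<Longrightarrow> arnoldi_vecs A b m ! j = arnoldi_vec A b j"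
  by (simp add: arnoldi_vecs_eq_map)

lemma arnoldi_resid_Suc:
  "arnoldi_resid A b (arnoldi_vecs A b (Suc j)) =
     (let W = arnoldi_W A b (Suc j); z = A *\<^sub>v arnoldi_vec A b j in z - W *\<^sub>v (W\<^sup>T *\<^sub>v z))"
  by (simp add: arnoldi_resid_def arnoldi_W_def Let_def arnoldi_vec_def)

lemma arnoldi_W_carrier:
  "b \<in> carrier_vec N \<Longrightarrow> arnoldi_W A b m \<in> carrier_mat N m"
  by (metis arnoldi_W_def carrier_vecD length_arnoldi_vecs mat_of_cols_carrier(1))

lemma arnoldi_resid_carrier:
  assumes "A \<in> carrier_mat N N" "b \<in> carrier_vec N"
  shows "arnoldi_resid A b (arnoldi_vecs A b j) \<in> carrier_vec N"
proof (cases j)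
  case 0
  then show ?thesis using assms by (simp add: arnoldi_resid_def)
next
  case (Suc i)
  \<comment> \<open>A difference of vectors takes its dimension from the second operand, here
    \<open>W *\<^sub>v (W\<^sup>T *\<^sub>v z)\<close>, so the number of rows of \<open>W\<close>
    decides.\<close>
  have "dim_row (arnoldi_W A b j) = N"
    using arnoldi_W_carrier[OF assms(2)] by blast
  then show ?thesis
    using Suc by (intro carrier_vecI) (simp add: arnoldi_resid_Suc Let_def del: arnoldi_vecs.simps)
qed

lemma arnoldi_vec_carrier:
  assumes "A \<in> carrier_mat N N" "b \<in> carrier_vec N"
  shows "arnoldi_vec A b j \<in> carrier_vec N"
  using arnoldi_resid_carrier[OF assms] by (simp add: arnoldi_vec_def Let_def)

lemma col_arnoldi_W:
  assumes "A \<in> carrier_mat N N" "b \<in> carrier_vec N" "j < m"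
  shows "col (arnoldi_W A b m) j = arnoldi_vec A b j"
  using assms arnoldi_vec_carrier[OF assms(1,2), of j] by (simp add: arnoldi_W_def)

lemma arnoldi_W_index:
  assumes "b \<in> carrier_vec N" "l < N" "j < m"
  shows "arnoldi_W A b m $$ (l, j) = arnoldi_vec A b j $ l"
  using assms by (auto simp: arnoldi_W_def mat_of_cols_index)

lemma vnorm_square: "vnorm v * vnorm v = v \<bullet> v"
  by (simp add: vnorm_def scalar_prod_def sum_nonneg)

lemma vnorm_eq_0_iff: "v \<in> carrier_vec n \<Longrightarrow> vnorm v = 0 \<longleftrightarrow> v = 0\<^sub>v n"
  by (auto simp: vnorm_def scalar_prod_def sum_nonneg_eq_0_iff)

text \<open>Also true after a breakdown, where both sides vanish.\<close>

lemma vnorm_smult_arnoldi_vec: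
  assumes "A \<in> carrier_mat N N" "b \<in> carrier_vec N"
  defines "r \<equiv> \<lambda>j. arnoldi_resid A b (arnoldi_vecs A b j)"
  shows "vnorm (r j) \<cdot>\<^sub>v arnoldi_vec A b j = r j"
  using vnorm_eq_0_iff[OF arnoldi_resid_carrier[OF assms(1,2), of j]]
  by (cases "vnorm (r j) = 0") (auto simp: arnoldi_vec_def Let_def r_def smult_smult_assoc)

text \<open>Entry \<open>(l, j)\<close> of the identity is the definition of residual
  \<open>j + 1\<close> solved for $A w_j$: the projection coefficients are the entries of column
  \<open>j\<close> of \<open>arnoldi_H\<close> up to the diagonal, and the norm of the residual is
  its subdiagonal entry.\<close>

theorem arnoldi_relation:
  assumes A: "A \<in> carrier_mat N N" and b: "b \<in> carrier_vec N"
  shows "A * arnoldi_W A b m = arnoldi_W A b (Suc m) * arnoldi_H A b m"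
proof (rule eq_matI)
  define w where "w = arnoldi_vec A b"
  note wc = arnoldi_vec_carrier[OF A b]
  note Wc = arnoldi_W_carrier[OF b, of A]
  have Hc: "arnoldi_H A b m \<in> carrier_mat (Suc m) m" by (simp add: arnoldi_H_def)
  fix l j
  assume "l < dim_row (arnoldi_W A b (Suc m) * arnoldi_H A b m)"
    and "j < dim_col (arnoldi_W A b (Suc m) * arnoldi_H A b m)"
  then have l: "l < N" and j: "j < m" using Wc[of "Suc m"] Hc by auto
  define z where "z = A *\<^sub>v w j"
  define r where "r = arnoldi_resid A b (arnoldi_vecs A b (Suc j))"
  let ?W = "arnoldi_W A b (Suc j)"
  have "r $ l = z $ l - (?W *\<^sub>v (?W\<^sup>T *\<^sub>v z)) $ l"
    using l Wc[of "Suc j"] unfolding r_def arnoldi_resid_Suc Let_def z_def w_def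
    by (subst index_minus_vec) auto
  \<comment> \<open>The product is expanded into its coordinates along the basis vectors, with
    coefficients \<open>w i \<bullet> z\<close>.\<close>
  also have "(?W *\<^sub>v (?W\<^sup>T *\<^sub>v z)) $ l = (\<Sum>i<Suc j. w i $ l * (w i \<bullet> z))"
    using l Wc[of "Suc j"] b A
    by (auto simp: scalar_prod_def[of "row _ _"] arnoldi_W_index col_arnoldi_W w_def
        atLeast0LessThan simp del: sum.lessThan_Suc intro!: sum.cong)
  finally have resid: "z $ l = r $ l + (\<Sum>i<Suc j. w i $ l * (w i \<bullet> z))" by simp
  have rl: "r $ l = w (Suc j) $ l * vnorm r"
  proof -
    have "r = vnorm r \<cdot>\<^sub>v w (Suc j)"
      using vnorm_smult_arnoldi_vec[OF A b, of "Suc j"] by (simp add: r_def w_def)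
    then have "r $ l = (vnorm r \<cdot>\<^sub>v w (Suc j)) $ l" by simp
    then show ?thesis using l wc[of "Suc j"] by (simp add: w_def mult.commute)
  qed
  \<comment> \<open>Column \<open>j\<close> of the Hessenberg matrix, extended by zero to every
    index so that the range of summation can be changed freely.\<close>
  define h where "h i = (if i \<le> j then w i \<bullet> z else if i = Suc j then vnorm r else 0)" for i
  have H: "arnoldi_H A b m $$ (i, j) = h i" if "i < Suc m" for i
    using that j by (auto simp: arnoldi_H_def h_def w_def z_def r_def simp del: arnoldi_vecs.simps)
  have "(arnoldi_W A b (Suc m) * arnoldi_H A b m) $$ (l, j) = (\<Sum>i<Suc m. w i $ l * h i)"
    using l j Wc[of "Suc m"] Hc b
    by (auto simp: scalar_prod_def H arnoldi_W_index w_def atLeast0LessThan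
        simp del: sum.lessThan_Suc intro!: sum.cong)
  \<comment> \<open>Below the subdiagonal the column vanishes; \<open>j < m\<close> ensures that the
    shorter range lies inside the longer one.\<close>
  also have "\<dots> = (\<Sum>i<Suc (Suc j). w i $ l * h i)"
    using j by (intro sum.mono_neutral_right) (auto simp: h_def)
  also have "\<dots> = (\<Sum>i<Suc j. w i $ l * h i) + w (Suc j) $ l * vnorm r"
    by (subst sum.lessThan_Suc) (simp add: h_def)
  also have "(\<Sum>i<Suc j. w i $ l * h i) = (\<Sum>i<Suc j. w i $ l * (w i \<bullet> z))"
    by (intro sum.cong) (auto simp: h_def)
  also have "\<dots> + w (Suc j) $ l * vnorm r = z $ l" using resid rl by simp
  also have "z $ l = (A * arnoldi_W A b m) $$ (l, j)"
    using l j A Wc[of m] col_arnoldi_W[OF A b j] by (simp add: z_def w_def)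
  finally show "(A * arnoldi_W A b m) $$ (l, j) =
      (arnoldi_W A b (Suc m) * arnoldi_H A b m) $$ (l, j)" by simp
qed (use A b in \<open>auto simp: arnoldi_H_def arnoldi_W_def\<close>)

text \<open>Since $W^TW = I$, the residual $r = z - WW^Tz$ satisfies $W^Tr = W^Tz - W^Tz = 0$, and
  normalizing only rescales $r$.\<close>

lemma arnoldi_vec_orthogonal:
  assumes A: "A \<in> carrier_mat N N" and b: "b \<in> carrier_vec N"
    and orth: "(arnoldi_W A b j)\<^sup>T * arnoldi_W A b j = 1\<^sub>m j"
    and ij: "i < j"
  shows "arnoldi_vec A b i \<bullet> arnoldi_vec A b j = 0"
proof -
  \<comment> \<open>As \<open>j\<close> is positive, the residual has the projection form and is not
    the starting vector \<open>b\<close>.\<close>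
  obtain j' where j': "j = Suc j'" using ij by (cases j) auto
  let ?W = "arnoldi_W A b j"
  have W: "?W \<in> carrier_mat N j" by (rule arnoldi_W_carrier[OF b])
  have wi: "arnoldi_vec A b i \<in> carrier_vec N" by (rule arnoldi_vec_carrier[OF A b])
  define z where "z = A *\<^sub>v arnoldi_vec A b j'"
  define r where "r = arnoldi_resid A b (arnoldi_vecs A b j)"
  have z: "z \<in> carrier_vec N" using A arnoldi_vec_carrier[OF A b] by (simp add: z_def)
  have y: "?W\<^sup>T *\<^sub>v z \<in> carrier_vec j" using W z by simp
  have r: "r = z - ?W *\<^sub>v (?W\<^sup>T *\<^sub>v z)"
    by (simp add: r_def j' arnoldi_resid_Suc Let_def z_def del: arnoldi_vecs.simps)
  have "?W\<^sup>T *\<^sub>v r = ?W\<^sup>T *\<^sub>v z - ?W\<^sup>T *\<^sub>v (?W *\<^sub>v (?W\<^sup>T *\<^sub>v z))"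
    unfolding r using W z y by (intro mult_minus_distrib_mat_vec[of _ j N]) auto
  also have "?W\<^sup>T *\<^sub>v (?W *\<^sub>v (?W\<^sup>T *\<^sub>v z)) = (?W\<^sup>T * ?W) *\<^sub>v (?W\<^sup>T *\<^sub>v z)"
    using W y by (intro assoc_mult_mat_vec[symmetric]) auto
  also have "\<dots> = ?W\<^sup>T *\<^sub>v z" using y by (simp add: orth)
  also have "?W\<^sup>T *\<^sub>v z - ?W\<^sup>T *\<^sub>v z = 0\<^sub>v j" using y by (rule minus_cancel_vec)
  finally have "(?W\<^sup>T *\<^sub>v r) $ i = 0" using ij by simp
  moreover have "(?W\<^sup>T *\<^sub>v r) $ i = arnoldi_vec A b i \<bullet> r"
    using W ij by (simp add: col_arnoldi_W[OF A b])
  moreover have "r \<in> carrier_vec N" unfolding r_def by (rule arnoldi_resid_carrier[OF A b])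
  ultimately show ?thesis
    using wi by (simp add: arnoldi_vec_def[of A b j] Let_def r_def)
qed

text \<open>Induction on the number of vectors: the Gram matrix gains one row and one column, which
  are zero off the diagonal by the preceding orthogonality and 1 on it by normalization.\<close>

lemma arnoldi_W_orthonormal:
  assumes A: "A \<in> carrier_mat N N" and b: "b \<in> carrier_vec N"
    and nz: "\<And>j. j < m \<Longrightarrow> vnorm (arnoldi_resid A b (arnoldi_vecs A b j)) \<noteq> 0"
  shows "(arnoldi_W A b m)\<^sup>T * arnoldi_W A b m = 1\<^sub>m m"
  using nz
proof (induction m)
  case 0
  show ?case using arnoldi_W_carrier[OF b, of A 0] by (intro eq_matI) auto
next
  case (Suc m)
  let ?w = "arnoldi_vec A b"
  note wc = arnoldi_vec_carrier[OF A b]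
  have IH: "(arnoldi_W A b m)\<^sup>T * arnoldi_W A b m = 1\<^sub>m m"
    using Suc by simp
  have gram: "((arnoldi_W A b n)\<^sup>T * arnoldi_W A b n) $$ (i, j) = ?w i \<bullet> ?w j"
    if "i < n" "j < n" for i j n
    using that arnoldi_W_carrier[OF b, of A n] by (simp add: col_arnoldi_W[OF A b])
  have old: "?w i \<bullet> ?w j = (if i = j then 1 else 0)" if "i < m" "j < m" for i j
    using gram[OF that] that by (simp add: IH)
  have new: "?w i \<bullet> ?w m = 0" if "i < m" for i
    by (rule arnoldi_vec_orthogonal[OF A b IH that])
  have unit: "?w m \<bullet> ?w m = 1"
  proof -
    define r where "r = arnoldi_resid A b (arnoldi_vecs A b m)"
    have r: "r \<in> carrier_vec N"
      unfolding r_def by (rule arnoldi_resid_carrier[OF A b])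
    \<comment> \<open>The absence of breakdown enters here: a zero residual would give the zero
      vector instead of a unit vector.\<close>
    have "vnorm r \<noteq> 0" unfolding r_def by (rule Suc.prems) simp
    have "?w m \<bullet> ?w m = (r \<bullet> r) / (vnorm r * vnorm r)"
      using r by (simp add: arnoldi_vec_def Let_def r_def[symmetric])
    then show ?thesis using \<open>vnorm r \<noteq> 0\<close> by (simp flip: vnorm_square)
  qed
  have new': "?w m \<bullet> ?w i = 0" if "i < m" for i
    using new[OF that] comm_scalar_prod[OF wc wc] by metis
  have "?w i \<bullet> ?w j = (if i = j then 1 else 0)" if "i < Suc m" "j < Suc m" for i j
    using that old new new' unit by (auto simp: less_Suc_eq)
  then show ?case
    using arnoldi_W_carrier[OF b, of A "Suc m"] gram[of _ "Suc m"]
    by (intro eq_matI) auto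
qed

text \<open>Allows the two matrix equations of the generalized SVD to be read one column at a
  time.\<close>

lemma col_mult_mat_diag:
  fixes Q :: "'a::comm_semiring_0 mat"
  assumes "Q \<in> carrier_mat n m" "k < m"
  shows "col (Q * mat_diag m d) k = d k \<cdot>\<^sub>v col Q k"
  using assms by (intro eq_vecI) (auto simp: mat_diag_mult_right mult.commute)

theorem proposition10:
  fixes A L W W' H Lm U V X :: "real mat"
    and b u v x :: "real vec"
    and s c :: "nat \<Rightarrow> real"
    and N m k :: nat
  assumes "A \<in> carrier_mat N N" and "L \<in> carrier_mat N N"
    and "b \<in> carrier_vec N" and "b \<noteq> 0\<^sub>v N"
    and "W = arnoldi_W A b m" and "W' = arnoldi_W A b (Suc m)" and "H = arnoldi_H A b m"
    and "\<forall>j<m. H $$ (Suc j, j) \<noteq> 0"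
    and "Lm = W\<^sup>T * L * W"
    and "is_gsvd H Lm U V X s c"
    and "k < m"
    and "u = W' *\<^sub>v col U k" and "v = W *\<^sub>v col V k" and "x = W *\<^sub>v col X k"
  shows "A *\<^sub>v x - s k \<cdot>\<^sub>v u = 0\<^sub>v N \<and> W\<^sup>T *\<^sub>v (L *\<^sub>v x - c k \<cdot>\<^sub>v v) = 0\<^sub>v m"
proof
  note A = assms(1) and L = assms(2) and b = assms(3) and km = \<open>k < m\<close>
  have W: "W \<in> carrier_mat N m" and W': "W' \<in> carrier_mat N (Suc m)"
    using arnoldi_W_carrier[OF b] assms(5,6) by auto
  have H: "H \<in> carrier_mat (Suc m) m" by (simp add: assms(7) arnoldi_H_def)
  have Lm: "Lm \<in> carrier_mat m m" using W L by (simp add: assms(9))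
  have U: "U \<in> carrier_mat (Suc m) m" and V: "V \<in> carrier_mat m m" and X: "X \<in> carrier_mat m m"
    and HX: "H * X = U * mat_diag m s" and LX: "Lm * X = V * mat_diag m c"
    using assms(10) H Lm by (auto simp: is_gsvd_def Let_def)
  have cols: "col X k \<in> carrier_vec m" "col U k \<in> carrier_vec (Suc m)" "col V k \<in> carrier_vec m"
    using U V X col_dim by (metis carrier_matD(1))+
  have Hx: "H *\<^sub>v col X k = s k \<cdot>\<^sub>v col U k"
    using col_mult2[OF H X km] col_mult_mat_diag[OF U km, of s] by (simp add: HX)
  have Lx: "Lm *\<^sub>v col X k = c k \<cdot>\<^sub>v col V k"
    using col_mult2[OF Lm X km] col_mult_mat_diag[OF V km, of c] by (simp add: LX)
  \<comment> \<open>Residual 0 is \<open>b\<close>, which is nonzero; the norm of residual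
    \<open>i + 1\<close> is the subdiagonal entry \<open>H $$ (i + 1, i)\<close>.\<close>
  have nz: "vnorm (arnoldi_resid A b (arnoldi_vecs A b j)) \<noteq> 0" if "j < m" for j
  proof (cases j)
    case 0
    then show ?thesis using vnorm_eq_0_iff[OF b] assms(4) by (simp add: arnoldi_resid_def)
  next
    case (Suc i)
    then show ?thesis using assms(8) that
      by (auto simp: assms(7) arnoldi_H_def simp del: arnoldi_vecs.simps dest!: spec[of _ i])
  qed
  have orth: "W\<^sup>T * W = 1\<^sub>m m"
    unfolding assms(5) by (rule arnoldi_W_orthonormal[OF A b nz])
  have xc: "x \<in> carrier_vec N" and uc: "u \<in> carrier_vec N" and vc: "v \<in> carrier_vec N"
    using assms(12-14) cols W W' by auto
  have "A *\<^sub>v x = (A * W) *\<^sub>v col X k"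
    using A W cols by (simp add: assms(14))
  \<comment> \<open>The range of $AW_m$ lies in that of $W_{m+1}$, so the first equation holds
    without projection.\<close>
  also have "\<dots> = W' *\<^sub>v (H *\<^sub>v col X k)"
    unfolding assms(5) arnoldi_relation[OF A b] assms(6,7)[symmetric]
    by (rule assoc_mult_mat_vec[OF W' H cols(1)])
  also have "\<dots> = s k \<cdot>\<^sub>v u"
    unfolding Hx using W' cols by (simp add: mult_mat_vec assms(12))
  finally show "A *\<^sub>v x - s k \<cdot>\<^sub>v u = 0\<^sub>v N" using uc by simp
  \<comment> \<open>$LW_m$ may leave the range of $W_m$, so only the projected residual is treated;
    both of its terms reduce to \<open>c k \<cdot>\<^sub>v col V k\<close>.\<close>
  have "W\<^sup>T *\<^sub>v (L *\<^sub>v x - c k \<cdot>\<^sub>v v) = W\<^sup>T *\<^sub>v (L *\<^sub>v x) - W\<^sup>T *\<^sub>v (c k \<cdot>\<^sub>v v)"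
    using W L xc vc by (intro mult_minus_distrib_mat_vec[of _ m N]) auto
  also have "W\<^sup>T *\<^sub>v (L *\<^sub>v x) = Lm *\<^sub>v col X k"
  proof -
    have "Lm *\<^sub>v col X k = (W\<^sup>T * L) *\<^sub>v x"
      unfolding assms(9,14) using W L cols by (intro assoc_mult_mat_vec[of _ m N _ m]) auto
    also have "\<dots> = W\<^sup>T *\<^sub>v (L *\<^sub>v x)"
      using W L xc by (intro assoc_mult_mat_vec[of _ m N _ N]) auto
    finally show ?thesis by simp
  qed
  also have "W\<^sup>T *\<^sub>v (c k \<cdot>\<^sub>v v) = c k \<cdot>\<^sub>v (W\<^sup>T *\<^sub>v v)"
    using W vc by (intro mult_mat_vec[of _ m N]) auto
  also have "W\<^sup>T *\<^sub>v v = (W\<^sup>T * W) *\<^sub>v col V k"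
    unfolding assms(13) using W cols by (intro assoc_mult_mat_vec[symmetric, of _ m N _ m]) auto
  also have "\<dots> = col V k" using cols by (simp add: orth)
  finally show "W\<^sup>T *\<^sub>v (L *\<^sub>v x - c k \<cdot>\<^sub>v v) = 0\<^sub>v m" using cols by (simp add: Lx)
qed

end
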